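(* Let $L$ be a completely distributive lattice, $G$ a group, and $\mu$ an $L$-subgroup of $G$. Then the only $L$-subgroup of $\mu$ that is both a normal $L$-subgroup of $\mu$ and an abnormal $L$-subgroup of $\mu$ is $\mu$ itself.
   Context: $L$ is a completely distributive (in particular complete) lattice with greatest element $1$ and least element $0$; $G$ is a group. An $L$-subset of $G$ is a function $G\to L$; $\eta\subseteq\nu$ means $\eta(x)\le\nu(x)$ for all $x\in G$; $(\eta\cup\nu)(x)=\eta(x)\vee\nu(x)$. An $L$-subgroup of $G$ is an $L$-subset $\mu$ with $\mu(xy)\ge\mu(x)\wedge\mu(y)$ and $\mu(x^{-1})=\mu(x)$ for all $x,y\in G$. An $L$-subgroup of $\mu$ is an $L$-subgroup $\eta$ of $G$ with $\eta\subseteq\mu$. It is a normal $L$-subgroup of $\mu$ if $\eta(yxy^{-1})\ge\eta(x)\wedge\mu(y)$ for all $x,y\in G$. For $a\in L$, $x\in G$, the $L$-point $a_x$ is the $L$-subset with value $a$ at $x$ and $0$ elsewhere; $a_x\in\mu$ means $\mu(x)\ge a$. For $\eta$ an $L$-subgroup of $\mu$ and $a_z\in\mu$, the conjugate $\eta^{a_z}$ is the $L$-subset $\eta^{a_z}(x)=a\wedge\eta(zxz^{-1})$, $x\in G$ (it is an $L$-subgroup of $\mu$). For $L$-subsets $\eta,\nu\subseteq\mu$, $\langle\eta,\nu\rangle$ is the $L$-subgroup of $\mu$ generated by $\eta\cup\nu$, i.e. the pointwise infimum of all $L$-subgroups $\theta$ of $\mu$ with $\eta\cup\nu\subseteq\theta$.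 An $L$-subgroup $\eta$ of $\mu$ is an abnormal $L$-subgroup of $\mu$ if for every $L$-point $a_x\in\mu$ one has $a_x\in\langle\eta,\eta^{a_x}\rangle$. *)

theory Defs
  imports "HOL-Algebra.Group" "HOL-Library.FuncSet"
begin

text \<open>
  An L-subset of \<open>G\<close> is a function on the carrier of \<open>G\<close>, rendered as an extensional function
  (\<open>undefined\<close> off the carrier), so that HOL equality of L-subsets is equality of functions
  \<open>G \<rightarrow> L\<close>. The class \<^class>\<open>complete_distrib_lattice\<close> is complete distributivity for arbitrary
  joins and meets.
\<close>

definition L_subset :: "('g, 'm) monoid_scheme \<Rightarrow> ('g \<Rightarrow> 'l::complete_distrib_lattice) \<Rightarrow> bool"
  where "L_subset G \<eta> \<longleftrightarrow> \<eta> \<in> carrier G \<rightarrow>\<^sub>E UNIV"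

definition L_contained ::
    "('g, 'm) monoid_scheme \<Rightarrow> ('g \<Rightarrow> 'l::complete_distrib_lattice) \<Rightarrow> ('g \<Rightarrow> 'l) \<Rightarrow> bool"
  where "L_contained G \<eta> \<nu> \<longleftrightarrow> (\<forall>x\<in>carrier G. \<eta> x \<le> \<nu> x)"

definition L_union ::
    "('g, 'm) monoid_scheme \<Rightarrow> ('g \<Rightarrow> 'l::complete_distrib_lattice) \<Rightarrow> ('g \<Rightarrow> 'l) \<Rightarrow> 'g \<Rightarrow> 'l"
  where "L_union G \<eta> \<nu> = (\<lambda>x\<in>carrier G. sup (\<eta> x) (\<nu> x))"

definition L_subgroup ::
    "('g, 'm) monoid_scheme \<Rightarrow> ('g \<Rightarrow> 'l::complete_distrib_lattice) \<Rightarrow> bool"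
  where "L_subgroup G \<mu> \<longleftrightarrow> L_subset G \<mu> \<and>
    (\<forall>x\<in>carrier G. \<forall>y\<in>carrier G. \<mu> (x \<otimes>\<^bsub>G\<^esub> y) \<ge> inf (\<mu> x) (\<mu> y)) \<and>
    (\<forall>x\<in>carrier G. \<mu> (inv\<^bsub>G\<^esub> x) = \<mu> x)"

definition L_subgroup_of ::
    "('g, 'm) monoid_scheme \<Rightarrow> ('g \<Rightarrow> 'l::complete_distrib_lattice) \<Rightarrow> ('g \<Rightarrow> 'l) \<Rightarrow> bool"
  where "L_subgroup_of G \<mu> \<eta> \<longleftrightarrow> L_subgroup G \<eta> \<and> L_contained G \<eta> \<mu>"

definition normal_L_subgroup_of ::
    "('g, 'm) monoid_scheme \<Rightarrow> ('g \<Rightarrow> 'l::complete_distrib_lattice) \<Rightarrow> ('g \<Rightarrow> 'l) \<Rightarrow> bool"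
  where "normal_L_subgroup_of G \<mu> \<eta> \<longleftrightarrow> L_subgroup_of G \<mu> \<eta> \<and>
    (\<forall>x\<in>carrier G. \<forall>y\<in>carrier G. \<eta> (y \<otimes>\<^bsub>G\<^esub> x \<otimes>\<^bsub>G\<^esub> inv\<^bsub>G\<^esub> y) \<ge> inf (\<eta> x) (\<mu> y))"

text \<open>
  The L-point \<open>a\<^sub>x\<close> is represented by the pair \<open>a\<close>, \<open>x\<close>; \<open>L_point_in G a x \<mu>\<close> is \<open>a\<^sub>x \<in> \<mu>\<close>.
\<close>

definition L_point_in ::
    "('g, 'm) monoid_scheme \<Rightarrow> 'l::complete_distrib_lattice \<Rightarrow> 'g \<Rightarrow> ('g \<Rightarrow> 'l) \<Rightarrow> bool"
  where "L_point_in G a x \<mu> \<longleftrightarrow> x \<in> carrier G \<and> \<mu> x \<ge> a"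

text \<open>\<open>L_conjugate G \<eta> a z\<close> is the conjugate of \<open>\<eta>\<close> by the L-point \<open>a\<^sub>z\<close>.\<close>

definition L_conjugate ::
    "('g, 'm) monoid_scheme \<Rightarrow> ('g \<Rightarrow> 'l::complete_distrib_lattice) \<Rightarrow> 'l \<Rightarrow> 'g \<Rightarrow> 'g \<Rightarrow> 'l"
  where "L_conjugate G \<eta> a z =
    (\<lambda>x\<in>carrier G. inf a (\<eta> (z \<otimes>\<^bsub>G\<^esub> x \<otimes>\<^bsub>G\<^esub> inv\<^bsub>G\<^esub> z)))"

definition L_generated ::
    "('g, 'm) monoid_scheme \<Rightarrow> ('g \<Rightarrow> 'l::complete_distrib_lattice) \<Rightarrow> ('g \<Rightarrow> 'l) \<Rightarrow> ('g \<Rightarrow> 'l)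
      \<Rightarrow> 'g \<Rightarrow> 'l"
  where "L_generated G \<mu> \<eta> \<nu> =
    (\<lambda>x\<in>carrier G. INF \<theta>\<in>{\<theta>. L_subgroup_of G \<mu> \<theta> \<and> L_contained G (L_union G \<eta> \<nu>) \<theta>}. \<theta> x)"

definition abnormal_L_subgroup_of ::
    "('g, 'm) monoid_scheme \<Rightarrow> ('g \<Rightarrow> 'l::complete_distrib_lattice) \<Rightarrow> ('g \<Rightarrow> 'l) \<Rightarrow> bool"
  where "abnormal_L_subgroup_of G \<mu> \<eta> \<longleftrightarrow> L_subgroup_of G \<mu> \<eta> \<and>
    (\<forall>a x. L_point_in G a x \<mu> \<longrightarrow>
      L_point_in G a x (L_generated G \<mu> \<eta> (L_conjugate G \<eta> a x)))"

end

theory Submission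
  imports Defs
begin

text \<open>
  Conjugates of a normal L-subgroup \<open>\<eta>\<close> of \<open>\<mu>\<close> are contained in \<open>\<eta>\<close>, so
  \<open>\<langle>\<eta>, \<eta>\<^bsup>a\<^sub>x\<^esup>\<rangle> = \<eta>\<close> for every L-point \<open>a\<^sub>x \<in> \<mu>\<close>. If \<open>\<eta>\<close> is also abnormal, then taking
  \<open>a = \<mu>(x)\<close> gives \<open>\<mu>(x) \<le> \<eta>(x)\<close>.
\<close>

text \<open>Containment compares values on the carrier only; off the carrier both functions are
  \<open>undefined\<close>, which upgrades pointwise agreement to equality of functions.\<close>

lemma L_contained_antisym:
  assumes "L_subset G \<eta>" "L_subset G \<nu>" "L_contained G \<eta> \<nu>" "L_contained G \<nu> \<eta>"
  shows "\<eta> = \<nu>"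
  using assms unfolding L_subset_def L_contained_def by (metis PiE_ext order.antisym)

text \<open>Half of the proof that \<open>\<mu>\<close> itself has both properties, so that the set
  in the theorem is not empty.\<close>

lemma normal_L_subgroup_of_self:
  assumes "group G" and mu: "L_subgroup G \<mu>"
  shows "normal_L_subgroup_of G \<mu> \<mu>"
proof -
  interpret group G by fact
  have "inf (\<mu> x) (\<mu> y) \<le> \<mu> (y \<otimes>\<^bsub>G\<^esub> x \<otimes>\<^bsub>G\<^esub> inv\<^bsub>G\<^esub> y)"
    if x: "x \<in> carrier G" and y: "y \<in> carrier G" for x y
  proof -
    \<comment> \<open>The value \<open>\<mu> y\<close> is duplicated: one copy pays for the factor
      \<open>y\<close>, the other for \<open>inv y\<close>, where \<open>\<mu>\<close> takes the
      same value.\<close>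
    have "inf (\<mu> x) (\<mu> y) \<le> inf (inf (\<mu> y) (\<mu> x)) (\<mu> y)"
      by (simp add: inf.coboundedI2 inf.commute)
    also have "\<dots> \<le> inf (\<mu> (y \<otimes>\<^bsub>G\<^esub> x)) (\<mu> (inv\<^bsub>G\<^esub> y))"
      using mu x y unfolding L_subgroup_def by (metis inf_mono order_refl)
    also have "\<dots> \<le> \<mu> (y \<otimes>\<^bsub>G\<^esub> x \<otimes>\<^bsub>G\<^esub> inv\<^bsub>G\<^esub> y)"
      using mu x y unfolding L_subgroup_def by (meson inv_closed m_closed)
    finally show ?thesis .
  qed
  with mu show ?thesis
    by (simp add: normal_L_subgroup_of_def L_subgroup_of_def L_contained_def)
qed

text \<open>Every \<open>\<theta>\<close> in the family lies above \<eta>, hence so does the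
  infimum; over an empty family it is the top element.\<close>

lemma L_contained_generated:
  "L_contained G \<eta> (L_generated G \<mu> \<eta> \<nu>)"
  unfolding L_contained_def L_generated_def L_union_def
  by (auto intro!: INF_greatest)

lemma L_generated_contained:
  assumes "L_subgroup_of G \<mu> \<theta>" "L_contained G \<eta> \<theta>" "L_contained G \<nu> \<theta>"
  shows "L_contained G (L_generated G \<mu> \<eta> \<nu>) \<theta>"
  using assms unfolding L_contained_def L_generated_def L_union_def
  by (auto intro!: INF_lower)

text \<open>The first generator \<open>\<mu>\<close> already contains each L-point of
  \<open>\<mu>\<close>, whatever the conjugate adds.\<close>

lemma abnormal_L_subgroup_of_self:
  assumes "L_subgroup G \<mu>"
  shows "abnormal_L_subgroup_of G \<mu> \<mu>"
  unfolding abnormal_L_subgroup_of_def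
proof (intro conjI allI impI)
  show "L_subgroup_of G \<mu> \<mu>"
    using assms by (simp add: L_subgroup_of_def L_contained_def)
  show "L_point_in G a x (L_generated G \<mu> \<mu> (L_conjugate G \<mu> a x))"
    if "L_point_in G a x \<mu>" for a x
    using that L_contained_generated[of G \<mu> \<mu> "L_conjugate G \<mu> a x"]
    unfolding L_point_in_def L_contained_def by (meson order_trans)
qed

lemma normal_L_conjugate_contained:
  assumes "group G" and mu: "L_subgroup G \<mu>"
    and eta: "normal_L_subgroup_of G \<mu> \<eta>" and az: "L_point_in G a z \<mu>"
  shows "L_contained G (L_conjugate G \<eta> a z) \<eta>"
  unfolding L_contained_def
proof
  interpret group G by fact
  fix x assume x: "x \<in> carrier G"
  have z: "z \<in> carrier G" and "a \<le> \<mu> z"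
    using az by (auto simp: L_point_in_def)
  let ?c = "z \<otimes>\<^bsub>G\<^esub> x \<otimes>\<^bsub>G\<^esub> inv\<^bsub>G\<^esub> z"
  have "L_conjugate G \<eta> a z x = inf a (\<eta> ?c)"
    using x by (simp add: L_conjugate_def)
  \<comment> \<open>The height \<open>a\<close> is traded for
    \<open>\<mu> (inv z) = \<mu> z\<close>, which is what normality asks of the conjugator
    \<open>inv z\<close> used next to carry \<open>?c\<close> back to \<open>x\<close>.\<close>
  also have "\<dots> \<le> inf (\<eta> ?c) (\<mu> (inv\<^bsub>G\<^esub> z))"
    using mu z \<open>a \<le> \<mu> z\<close> by (auto simp: L_subgroup_def intro: le_infI1)
  also have "\<dots> \<le> \<eta> (inv\<^bsub>G\<^esub> z \<otimes>\<^bsub>G\<^esub> ?c \<otimes>\<^bsub>G\<^esub> inv\<^bsub>G\<^esub> (inv\<^bsub>G\<^esub> z))"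
    using eta x z unfolding normal_L_subgroup_of_def by blast
  also have "inv\<^bsub>G\<^esub> z \<otimes>\<^bsub>G\<^esub> ?c \<otimes>\<^bsub>G\<^esub> inv\<^bsub>G\<^esub> (inv\<^bsub>G\<^esub> z) = x"
    using x z by (simp add: m_assoc inv_solve_left')
  finally show "L_conjugate G \<eta> a z x \<le> \<eta> x" .
qed

lemma normal_abnormal_L_subgroup_of_eq:
  assumes "group G" and mu: "L_subgroup G \<mu>"
    and normal: "normal_L_subgroup_of G \<mu> \<eta>" and abnormal: "abnormal_L_subgroup_of G \<mu> \<eta>"
  shows "\<eta> = \<mu>"
proof (rule L_contained_antisym)
  have sub: "L_subgroup_of G \<mu> \<eta>"
    using normal by (simp add: normal_L_subgroup_of_def)
  then show "L_subset G \<eta>" "L_contained G \<eta> \<mu>"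
    by (auto simp: L_subgroup_of_def L_subgroup_def)
  show "L_subset G \<mu>"
    using mu by (simp add: L_subgroup_def)
  show "L_contained G \<mu> \<eta>"
    unfolding L_contained_def
  proof
    fix x assume x: "x \<in> carrier G"
    let ?gen = "L_generated G \<mu> \<eta> (L_conjugate G \<eta> (\<mu> x) x)"
    have pt: "L_point_in G (\<mu> x) x \<mu>"
      using x by (simp add: L_point_in_def)
    have "\<mu> x \<le> ?gen x"
      using abnormal pt by (auto simp: abnormal_L_subgroup_of_def L_point_in_def)
    \<comment> \<open>Here \<eta> is itself a member of the family whose infimum is
      \<open>?gen\<close>, because it contains its conjugate.\<close>
    moreover have "L_contained G ?gen \<eta>"
      using sub normal_L_conjugate_contained[OF assms(1) mu normal pt]
      by (intro L_generated_contained) (auto simp: L_contained_def)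
    ultimately show "\<mu> x \<le> \<eta> x"
      using x by (auto simp: L_contained_def intro: order_trans)
  qed
qed

theorem theorem3p10:
  fixes G :: "('g, 'm) monoid_scheme"
    and \<mu> :: "'g \<Rightarrow> 'l::complete_distrib_lattice"
  assumes "group G"
    and "L_subgroup G \<mu>"
  shows "{\<eta>. normal_L_subgroup_of G \<mu> \<eta> \<and> abnormal_L_subgroup_of G \<mu> \<eta>} = {\<mu>}"
  using assms normal_L_subgroup_of_self abnormal_L_subgroup_of_self
    normal_abnormal_L_subgroup_of_eq by blast

end
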